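(* Let $f\in C([-1,1])$. Express the polynomial $\hat P_{r,n}[f]$ and its successive derivatives in the Chebyshev basis of the first kind $\{T_0,\dots,T_r\}$, that is, $$\hat P^{(\nu)}_{r,n}[f](x)=\sum_{i=0}^r\hat a^{(\nu)}_iT_i(x),\qquad x\in[-1,1],\quad \nu=0,1,\dots,r,$$ where $\hat P^{(0)}_{r,n}[f]=\hat P_{r,n}[f]$, and set $\hat a^{(\nu)}_{r+1}:=0$ for all $\nu$. Then for each $\nu\in\{1,\dots,r\}$ $$\hat a^{(\nu)}_0=\sum_{j=0}^{\lfloor r/2\rfloor}(2j+1)\,\hat a^{(\nu-1)}_{2j+1},\qquad \hat a^{(\nu)}_i=2\sum_{j=0}^{\lfloor (r-i)/2\rfloor}(i+2j+1)\,\hat a^{(\nu-1)}_{i+2j+1},\quad i=1,\dots,r.$$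
   Context: Let $n$ be a (sufficiently large) positive integer and let $X_n=\{-1+\tfrac{2}{n}i : i=0,\dots,n\}$ be the set of $n+1$ equispaced nodes in $[-1,1]$. Put $m=\lfloor \pi\sqrt{n/2}\rfloor$, $p=\lfloor \tfrac{\pi}{\sqrt2}\sqrt{n/6}\rfloor$, $r=m+p+1$; $n$ is large enough that $r\le n$. $X'_m=\{x'_0,\dots,x'_m\}\subset X_n$ is the mock-Chebyshev subset: $m+1$ pairwise distinct nodes of $X_n$ that best mimic the Chebyshev--Lobatto nodes, i.e. $x'_k$ is the node of $X_n$ closest to $-\cos(k\pi/m)$ (a neighbouring grid node being used if necessary to keep the nodes distinct). The elements of $X_n$ are reordered as $x_0,\dots,x_n$ so that $x_i=x'_i$ for $i=0,\dots,m$. $T_k(x)=\cos(k\arccos x)$, $k=0,\dots,r$, are the Chebyshev polynomials of the first kind, a basis of the space $\Pi_r$ of polynomials of degree $\le r$. Let $V=[T_j(x_i)]_{i=0,\dots,n;\ j=0,\dots,r}$ and $C=[T_j(x_i)]_{i=0,\dots,m;\ j=0,\dots,r}$. The KKT matrix $$M=\begin{bmatrix}2V^TV & C^T\\ C&0\end{bmatrix}$$ is nonsingular. For $f\in C([-1,1])$ let $\boldsymbol b=[f(x_0),\dots,f(x_n)]^T$, $\boldsymbol d=[f(x_0),\dots,f(x_m)]^T$, and let $(\hat{\boldsymbol a},\hat{\boldsymbol z})$ with $\hat{\boldsymbol a}=[\hat a_0,\dots,\hat a_r]^T$, $\hat{\boldsymbol z}\in\mathbb R^{m+1}$, be the unique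 solution of $$M\begin{bmatrix}\hat{\boldsymbol a}\\ \hat{\boldsymbol z}\end{bmatrix}=\begin{bmatrix}2V^T\boldsymbol b\\ \boldsymbol d\end{bmatrix}.$$ The constrained mock-Chebyshev least squares operator is $\hat P_{r,n}[f](x)=\sum_{i=0}^r\hat a_iT_i(x)$, $x\in[-1,1]$, and $\hat P^{(\nu)}_{r,n}[f]$ is the $\nu$-th derivative of this polynomial. *)

theory Defs
  imports Complex_Main "HOL-Computational_Algebra.Polynomial" "Jordan_Normal_Form.Determinant"
begin

subsection \<open>Chebyshev polynomials of the first kind\<close>

definition cheb_T :: "nat \<Rightarrow> real poly" where
  "cheb_T k = (THE p. \<forall>t\<in>{-1..1}. poly p t = cos (real k * arccos t))"

lemma poly_eqI_unit_interval:
  fixes p q :: "real poly"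
  assumes "\<And>t. t \<in> {-1..1} \<Longrightarrow> poly p t = poly q t"
  shows "p = q"
proof (rule ccontr)
  assume "p \<noteq> q"
  then have "finite {t. poly (p - q) t = 0}"
    by (intro poly_roots_finite) simp
  moreover have "{-1..1} \<subseteq> {t. poly (p - q) t = 0}"
    using assms by auto
  ultimately have "finite {-1..1::real}"
    using finite_subset by blast
  then show False
    using infinite_Icc[of "-1" "1::real"] by simp
qed

fun cheb_rec :: "nat \<Rightarrow> real poly" where
  "cheb_rec 0 = 1"
| "cheb_rec (Suc 0) = [:0, 1:]"
| "cheb_rec (Suc (Suc k)) = [:0, 2:] * cheb_rec (Suc k) - cheb_rec k"

lemma poly_cheb_rec_cos: "poly (cheb_rec k) (cos \<theta>) = cos (real k * \<theta>)"
proof (induction k rule: cheb_rec.induct)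
  case (3 k)
  have "cos (real (Suc (Suc k)) * \<theta>) = cos (real (Suc k) * \<theta> + \<theta>)"
    and "cos (real k * \<theta>) = cos (real (Suc k) * \<theta> - \<theta>)"
    by (simp_all add: algebra_simps)
  with 3 show ?case by (simp add: cos_add cos_diff)
qed simp_all

lemma cheb_T_eq_rec: "cheb_T k = cheb_rec k"
  unfolding cheb_T_def
proof (rule the_equality)
  show *: "\<forall>t\<in>{-1..1}. poly (cheb_rec k) t = cos (real k * arccos t)"
    using poly_cheb_rec_cos[of k] by (metis atLeastAtMost_iff cos_arccos)
  fix p assume "\<forall>t\<in>{-1..1}. poly p t = cos (real k * arccos t)"
  with * show "p = cheb_rec k" by (intro poly_eqI_unit_interval) simp
qed

lemma poly_cheb_T:
  assumes "t \<in> {-1..1}"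
  shows "poly (cheb_T k) t = cos (real k * arccos t)"
  using assms poly_cheb_rec_cos[of k "arccos t"] by (simp add: cheb_T_eq_rec)

lemma degree_cheb_T: "degree (cheb_T k) = k"
proof -
  have "degree (cheb_rec k) = k \<and> cheb_rec k \<noteq> 0"
  proof (induction k rule: cheb_rec.induct)
    case (3 k)
    have *: "degree ([:0, 2:] * cheb_rec (Suc k)) = Suc (Suc k)"
      using 3 by (subst degree_mult_eq) auto
    have "degree ([:0, 2:] * cheb_rec (Suc k) - cheb_rec k) = Suc (Suc k)"
      using 3 * degree_add_eq_left[of "- cheb_rec k" "[:0, 2:] * cheb_rec (Suc k)"] by simp
    then show ?case by (metis cheb_rec.simps(3) degree_0 nat.distinct(1))
  qed simp_all
  then show ?thesis by (simp add: cheb_T_eq_rec)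
qed

lemma cheb_T_nonzero: "cheb_T k \<noteq> 0"
  using degree_cheb_T[of k] by (cases k) (auto simp: cheb_T_eq_rec)

lemma coeff_cheb_T_self: "coeff (cheb_T k) k \<noteq> 0"
  using cheb_T_nonzero[of k] degree_cheb_T[of k] by (metis leading_coeff_0_iff)

lemma degree_cheb_sum_le: "degree (\<Sum>i\<le>r. smult (c i) (cheb_T i)) \<le> r"
  by (intro degree_sum_le) (auto intro: order.trans[OF degree_smult_le] simp: degree_cheb_T)

text \<open>The polynomials \<open>cheb_T 0, \<dots>, cheb_T r\<close> form a basis of the polynomials of degree at most \<open>r\<close>.\<close>

lemma cheb_T_span:
  "degree q \<le> r \<Longrightarrow> \<exists>c. q = (\<Sum>i\<le>r. smult (c i) (cheb_T i))"
proof (induction r arbitrary: q)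
  case 0
  then obtain a where "q = [:a:]" by (metis degree_eq_zeroE le_zero_eq)
  then show ?case by (intro exI[of _ "\<lambda>_. a"]) (simp add: cheb_T_eq_rec)
next
  case (Suc r)
  define b where "b = coeff q (Suc r) / coeff (cheb_T (Suc r)) (Suc r)"
  have "degree (q - smult b (cheb_T (Suc r))) \<le> r"
  proof (rule degree_le, intro allI impI)
    fix i assume "r < i"
    then consider "i = Suc r" | "i > Suc r" by linarith
    then show "coeff (q - smult b (cheb_T (Suc r))) i = 0"
    proof cases
      case 1
      then show ?thesis using coeff_cheb_T_self by (simp add: b_def)
    next
      case 2
      then show ?thesis using Suc.prems by (simp add: coeff_eq_0 degree_cheb_T)
    qed
  qed
  from Suc.IH[OF this] obtain c
    where c: "q - smult b (cheb_T (Suc r)) = (\<Sum>i\<le>r. smult (c i) (cheb_T i))" by blast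
  have "q = (\<Sum>i\<le>Suc r. smult ((c(Suc r := b)) i) (cheb_T i))"
    using c by (simp add: algebra_simps)
  then show ?case by blast
qed

lemma cheb_T_independent:
  "(\<Sum>i\<le>r. smult (c i) (cheb_T i)) = 0 \<Longrightarrow> i \<le> r \<Longrightarrow> c i = 0"
proof (induction r arbitrary: i)
  case 0
  then show ?case by (simp add: cheb_T_nonzero)
next
  case (Suc r)
  have "coeff (\<Sum>i\<le>r. smult (c i) (cheb_T i)) (Suc r) = 0"
    using degree_cheb_sum_le[where r = r and c = c] by (intro coeff_eq_0) linarith
  moreover have "coeff (\<Sum>i\<le>Suc r. smult (c i) (cheb_T i)) (Suc r) = 0"
    using Suc.prems(1) by simp
  ultimately have "c (Suc r) = 0"
    using coeff_cheb_T_self[of "Suc r"] by simp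
  with Suc show ?case by (cases "i = Suc r") auto
qed

subsection \<open>Equispaced nodes and the mock-Chebyshev subset\<close>

definition grid :: "nat \<Rightarrow> real set" where
  "grid n = (\<lambda>i. -1 + 2 / real n * real i) ` {0..n}"

definition mc_m :: "nat \<Rightarrow> nat" where
  "mc_m n = nat \<lfloor>pi * sqrt (real n / 2)\<rfloor>"

definition mc_p :: "nat \<Rightarrow> nat" where
  "mc_p n = nat \<lfloor>pi / sqrt 2 * sqrt (real n / 6)\<rfloor>"

definition mc_r :: "nat \<Rightarrow> nat" where
  "mc_r n = mc_m n + mc_p n + 1"

definition cheb_lobatto :: "nat \<Rightarrow> nat \<Rightarrow> real" where
  "cheb_lobatto m k = - cos (real k * pi / real m)"

definition nearest_node :: "nat \<Rightarrow> real \<Rightarrow> real \<Rightarrow> bool" where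
  "nearest_node n t y \<longleftrightarrow> y \<in> grid n \<and> (\<forall>w\<in>grid n. \<bar>y - t\<bar> \<le> \<bar>w - t\<bar>)"

text \<open>
  Here \<open>y k\<close> is a grid node nearest to the \<open>k\<close>-th Chebyshev--Lobatto node (in case of a tie, any of
  the two). It is replaced by an adjacent grid node, at distance \<open>2 / n\<close>, only if the same
  node \<open>y k\<close> is already used as the nearest node for another index \<open>j\<close>.
\<close>

definition mock_chebyshev :: "nat \<Rightarrow> (nat \<Rightarrow> real) \<Rightarrow> bool" where
  "mock_chebyshev n x \<longleftrightarrow>
     inj_on x {0..mc_m n} \<and> x ` {0..mc_m n} \<subseteq> grid n \<and>
     (\<exists>y. (\<forall>k\<le>mc_m n. nearest_node n (cheb_lobatto (mc_m n) k) (y k)) \<and>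
          (\<forall>k\<le>mc_m n. x k = y k \<or>
             \<bar>x k - y k\<bar> = 2 / real n \<and> (\<exists>j\<le>mc_m n. j \<noteq> k \<and> y j = y k \<and> x j = y j)))"

definition mock_chebyshev_ordering :: "nat \<Rightarrow> (nat \<Rightarrow> real) \<Rightarrow> bool" where
  "mock_chebyshev_ordering n x \<longleftrightarrow> bij_betw x {0..n} (grid n) \<and> mock_chebyshev n x"

subsection \<open>The constrained mock-Chebyshev least squares operator\<close>

definition V_mat :: "nat \<Rightarrow> (nat \<Rightarrow> real) \<Rightarrow> real mat" where
  "V_mat n x = mat (n + 1) (mc_r n + 1) (\<lambda>(i, j). poly (cheb_T j) (x i))"

definition C_mat :: "nat \<Rightarrow> (nat \<Rightarrow> real) \<Rightarrow> real mat" where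
  "C_mat n x = mat (mc_m n + 1) (mc_r n + 1) (\<lambda>(i, j). poly (cheb_T j) (x i))"

definition KKT_mat :: "nat \<Rightarrow> (nat \<Rightarrow> real) \<Rightarrow> real mat" where
  "KKT_mat n x = four_block_mat
     (2 \<cdot>\<^sub>m (transpose_mat (V_mat n x) * V_mat n x)) (transpose_mat (C_mat n x))
     (C_mat n x) (0\<^sub>m (mc_m n + 1) (mc_m n + 1))"

definition b_vec :: "nat \<Rightarrow> (nat \<Rightarrow> real) \<Rightarrow> (real \<Rightarrow> real) \<Rightarrow> real vec" where
  "b_vec n x f = vec (n + 1) (\<lambda>i. f (x i))"

definition d_vec :: "nat \<Rightarrow> (nat \<Rightarrow> real) \<Rightarrow> (real \<Rightarrow> real) \<Rightarrow> real vec" where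
  "d_vec n x f = vec (mc_m n + 1) (\<lambda>i. f (x i))"

definition KKT_solution ::
  "nat \<Rightarrow> (nat \<Rightarrow> real) \<Rightarrow> (real \<Rightarrow> real) \<Rightarrow> real vec \<Rightarrow> real vec \<Rightarrow> bool" where
  "KKT_solution n x f a z \<longleftrightarrow>
     a \<in> carrier_vec (mc_r n + 1) \<and> z \<in> carrier_vec (mc_m n + 1) \<and>
     KKT_mat n x *\<^sub>v (a @\<^sub>v z)
       = (2 \<cdot>\<^sub>v (transpose_mat (V_mat n x) *\<^sub>v b_vec n x f)) @\<^sub>v d_vec n x f"

definition cmc_coeffs :: "nat \<Rightarrow> (nat \<Rightarrow> real) \<Rightarrow> (real \<Rightarrow> real) \<Rightarrow> real vec" where
  "cmc_coeffs n x f = fst (THE (a, z). KKT_solution n x f a z)"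

definition cmc_ls :: "nat \<Rightarrow> (nat \<Rightarrow> real) \<Rightarrow> (real \<Rightarrow> real) \<Rightarrow> real poly" where
  "cmc_ls n x f = (\<Sum>i\<le>mc_r n. smult (cmc_coeffs n x f $ i) (cheb_T i))"

lemma degree_cmc_ls: "degree (cmc_ls n x f) \<le> mc_r n"
  unfolding cmc_ls_def by (rule degree_cheb_sum_le)

text \<open>The matrix is nonsingular and the system has a unique solution, so the operator is well defined.\<close>

lemma KKT_mat_carrier:
  "KKT_mat n x \<in> carrier_mat (mc_r n + 1 + (mc_m n + 1)) (mc_r n + 1 + (mc_m n + 1))"
  unfolding KKT_mat_def by (rule four_block_carrier_mat) (auto simp: V_mat_def)

lemma smult_mat_mult_vec:
  fixes A :: "real mat"
  assumes "A \<in> carrier_mat k l" and "v \<in> carrier_vec l"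
  shows "(c \<cdot>\<^sub>m A) *\<^sub>v v = c \<cdot>\<^sub>v (A *\<^sub>v v)"
  using assms by (intro eq_vecI) (auto simp: scalar_prod_def sum_distrib_left mult.assoc)

lemma mult_mat_vec_zero:
  fixes A :: "real mat"
  assumes "A \<in> carrier_mat k l"
  shows "A *\<^sub>v 0\<^sub>v l = 0\<^sub>v k"
  using assms by (intro eq_vecI) (auto simp: scalar_prod_def)

lemma det_KKT_mat_nonzero:
  assumes le: "mc_r n \<le> n" and inj: "inj_on x {0..n}"
  shows "det (KKT_mat n x) \<noteq> 0"
proof
  define r m where "r = mc_r n" and "m = mc_m n"
  define V C where "V = V_mat n x" and "C = C_mat n x"
  have V: "V \<in> carrier_mat (n + 1) (r + 1)" and C: "C \<in> carrier_mat (m + 1) (r + 1)"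
    by (auto simp: V_def V_mat_def C_def C_mat_def r_def m_def)
  have mr: "m \<le> r" by (simp add: m_def r_def mc_r_def)
  note carr = KKT_mat_carrier[of n x, folded r_def m_def]
  assume "det (KKT_mat n x) = 0"
  then obtain v where v: "v \<in> carrier_vec (r + 1 + (m + 1))" "v \<noteq> 0\<^sub>v (r + 1 + (m + 1))"
    and Mv: "KKT_mat n x *\<^sub>v v = 0\<^sub>v (r + 1 + (m + 1))"
    using det_0_iff_vec_prod_zero[OF carr] by blast
  define a z where "a = vec_first v (r + 1)" and "z = vec_last v (m + 1)"
  have az: "v = a @\<^sub>v z" and a: "a \<in> carrier_vec (r + 1)" and z: "z \<in> carrier_vec (m + 1)"
    using v(1) by (auto simp: a_def z_def)
  let ?A = "2 \<cdot>\<^sub>m (transpose_mat V * V)"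
  have A: "?A \<in> carrier_mat (r + 1) (r + 1)" using V by auto
  have split0: "(0\<^sub>v (r + 1 + (m + 1)) :: real vec) = 0\<^sub>v (r + 1) @\<^sub>v 0\<^sub>v (m + 1)"
    by (intro eq_vecI) auto
  have "KKT_mat n x *\<^sub>v v
      = (?A *\<^sub>v a + transpose_mat C *\<^sub>v z) @\<^sub>v (C *\<^sub>v a + 0\<^sub>m (m + 1) (m + 1) *\<^sub>v z)"
    unfolding KKT_mat_def az V_def[symmetric] C_def[symmetric] m_def[symmetric]
    using V C a z by (intro four_block_mat_mult_vec) auto
  with Mv split0 have
    "(?A *\<^sub>v a + transpose_mat C *\<^sub>v z) @\<^sub>v (C *\<^sub>v a + 0\<^sub>m (m + 1) (m + 1) *\<^sub>v z)
       = 0\<^sub>v (r + 1) @\<^sub>v 0\<^sub>v (m + 1)" by simp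
  moreover have "?A *\<^sub>v a + transpose_mat C *\<^sub>v z \<in> carrier_vec (r + 1)"
    using A C a z by auto
  ultimately have
    top: "?A *\<^sub>v a + transpose_mat C *\<^sub>v z = 0\<^sub>v (r + 1)" and
    bot: "C *\<^sub>v a + 0\<^sub>m (m + 1) (m + 1) *\<^sub>v z = 0\<^sub>v (m + 1)"
    by (auto dest: append_vec_eq[THEN iffD1, rotated 2])
  have "C *\<^sub>v a = C *\<^sub>v a + 0\<^sub>m (m + 1) (m + 1) *\<^sub>v z"
    using C a z by (intro eq_vecI) auto
  with bot have Ca: "C *\<^sub>v a = 0\<^sub>v (m + 1)" by simp
  have "(?A *\<^sub>v a + transpose_mat C *\<^sub>v z) \<bullet> a = 0"
    unfolding top using a by simp
  moreover have "(?A *\<^sub>v a + transpose_mat C *\<^sub>v z) \<bullet> a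
      = (?A *\<^sub>v a) \<bullet> a + (transpose_mat C *\<^sub>v z) \<bullet> a"
    using A C a z by (intro add_scalar_prod_distrib) auto
  moreover have "(transpose_mat C *\<^sub>v z) \<bullet> a = z \<bullet> (C *\<^sub>v a)"
    by (rule transpose_vec_mult_scalar[OF C a z])
  moreover have "?A *\<^sub>v a = 2 \<cdot>\<^sub>v (transpose_mat V *\<^sub>v (V *\<^sub>v a))"
  proof -
    have "?A *\<^sub>v a = 2 \<cdot>\<^sub>v ((transpose_mat V * V) *\<^sub>v a)"
      using V a by (intro smult_mat_mult_vec) auto
    also have "(transpose_mat V * V) *\<^sub>v a = transpose_mat V *\<^sub>v (V *\<^sub>v a)"
      using V a by (intro assoc_mult_mat_vec) auto
    finally show ?thesis .
  qed
  moreover have "(transpose_mat V *\<^sub>v (V *\<^sub>v a)) \<bullet> a = (V *\<^sub>v a) \<bullet> (V *\<^sub>v a)"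
    using V a by (intro transpose_vec_mult_scalar) auto
  ultimately have "(V *\<^sub>v a) \<bullet> (V *\<^sub>v a) = 0"
    using V a z Ca by simp
  then have Va: "(V *\<^sub>v a) $ i = 0" if "i \<le> n" for i
    using that V unfolding scalar_prod_def
    by (subst (asm) sum_nonneg_eq_0_iff) auto
  define q where "q = (\<Sum>j\<le>r. smult (a $ j) (cheb_T j))"
  have "poly q (x i) = 0" if "i \<le> n" for i
  proof -
    have "poly q (x i) = (V *\<^sub>v a) $ i"
      using that a unfolding q_def V_def V_mat_def r_def
      by (simp add: poly_sum scalar_prod_def atLeast0LessThan lessThan_Suc_atMost mult.commute)
    with Va that show ?thesis by simp
  qed
  moreover have "degree q \<le> r" unfolding q_def by (rule degree_cheb_sum_le)
  moreover have "card (x ` {0..n}) = n + 1" using inj by (simp add: card_image)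
  ultimately have "q = 0"
    using card_poly_roots_bound[of q] card_mono[of "{t. poly q t = 0}" "x ` {0..n}"]
      poly_roots_finite[of q] le by (fastforce simp: r_def)
  then have "a $ j = 0" if "j \<le> r" for j
    using cheb_T_independent that unfolding q_def by blast
  then have a0: "a = 0\<^sub>v (r + 1)" using a by (intro eq_vecI) auto
  have Cz: "transpose_mat C *\<^sub>v z = 0\<^sub>v (r + 1)"
  proof -
    have "?A *\<^sub>v a = 0\<^sub>v (r + 1)" 
      unfolding a0 by (rule mult_mat_vec_zero[OF A])
    with top C z show ?thesis by simp
  qed
  have orth: "(\<Sum>i\<le>m. z $ i * poly s (x i)) = 0" if "degree s \<le> r" for s
  proof -
    obtain c where c: "s = (\<Sum>j\<le>r. smult (c j) (cheb_T j))"
      using cheb_T_span[OF \<open>degree s \<le> r\<close>] by blast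
    have *: "(\<Sum>i\<le>m. z $ i * poly (cheb_T j) (x i)) = 0" if "j \<le> r" for j
    proof -
      have "(transpose_mat C *\<^sub>v z) $ j = (\<Sum>i\<le>m. z $ i * poly (cheb_T j) (x i))"
        using that z C unfolding C_def C_mat_def m_def r_def
        by (simp add: scalar_prod_def atLeast0LessThan lessThan_Suc_atMost mult.commute)
      with Cz that show ?thesis by simp
    qed
    have "(\<Sum>i\<le>m. z $ i * poly s (x i))
        = (\<Sum>i\<le>m. \<Sum>j\<le>r. c j * (z $ i * poly (cheb_T j) (x i)))"
      unfolding c by (simp add: poly_sum sum_distrib_left algebra_simps)
    also have "\<dots> = (\<Sum>j\<le>r. c j * (\<Sum>i\<le>m. z $ i * poly (cheb_T j) (x i)))"
      by (subst sum.swap) (simp add: sum_distrib_left)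
    also have "\<dots> = 0" using * by simp
    finally show ?thesis .
  qed
  have "z $ k = 0" if k: "k \<le> m" for k
  proof -
    define s where "s = (\<Prod>i\<in>{..m} - {k}. [:- x i, 1:])"
    have "degree s \<le> m"
      unfolding s_def using degree_prod_sum_le[of "{..m} - {k}" "\<lambda>i. [:- x i, 1:]"] k by simp
    then have "(\<Sum>i\<le>m. z $ i * poly s (x i)) = 0" using mr by (intro orth) simp
    moreover have "(\<Sum>i\<le>m. z $ i * poly s (x i)) = (\<Sum>i\<in>{k}. z $ i * poly s (x i))"
      using k by (intro sum.mono_neutral_right) (auto simp: s_def poly_prod)
    moreover have "poly s (x k) \<noteq> 0"
      using k inj le mr by (auto simp: s_def poly_prod r_def inj_on_def)
    ultimately show ?thesis by simp
  qed
  then have "z = 0\<^sub>v (m + 1)" using z by (intro eq_vecI) auto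
  with a0 az split0 v(2) show False by simp
qed

lemma invertible_KKT_mat:
  assumes "mc_r n \<le> n" and "mock_chebyshev_ordering n x"
  shows "invertible_mat (KKT_mat n x)"
proof -
  have inj: "inj_on x {0..n}"
    using assms(2) by (simp add: mock_chebyshev_ordering_def bij_betw_def)
  from det_non_zero_imp_unit[OF KKT_mat_carrier det_KKT_mat_nonzero[OF assms(1) inj]]
  show ?thesis
    using KKT_mat_carrier[of n x]
    by (auto simp: Units_def ring_mat_def invertible_mat_def inverts_mat_def)
qed

lemma KKT_solution_ex1:
  assumes "mc_r n \<le> n" and "mock_chebyshev_ordering n x"
  shows "\<exists>!(a, z). KKT_solution n x f a z"
proof -
  define N where "N = mc_r n + 1 + (mc_m n + 1)"
  define M where "M = KKT_mat n x"
  define w where "w = (2 \<cdot>\<^sub>v (transpose_mat (V_mat n x) *\<^sub>v b_vec n x f)) @\<^sub>v d_vec n x f"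
  have M: "M \<in> carrier_mat N N" using KKT_mat_carrier by (simp add: M_def N_def)
  have w: "w \<in> carrier_vec N" 
  proof -
    have "transpose_mat (V_mat n x) *\<^sub>v b_vec n x f \<in> carrier_vec (mc_r n + 1)"
      by (rule mult_mat_vec_carrier[where n = "n + 1"])
         (simp_all add: V_mat_def b_vec_def)
    then show ?thesis
      unfolding w_def N_def by (intro append_carrier_vec) (simp_all add: d_vec_def)
  qed
  obtain B where B: "M * B = 1\<^sub>m N" "B * M = 1\<^sub>m (dim_row B)"
    using invertible_KKT_mat[OF assms] M
    by (auto simp: invertible_mat_def inverts_mat_def M_def)
  have Bc: "B \<in> carrier_mat N N"
    using arg_cong[OF B(1), of dim_col] arg_cong[OF B(2), of dim_col] M by auto
  have BM: "B * M = 1\<^sub>m N" using B(2) Bc by simp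
  define u where "u = B *\<^sub>v w"
  have u: "u \<in> carrier_vec N" using Bc w by (simp add: u_def)
  have Mu: "M *\<^sub>v u = w"
    unfolding u_def using assoc_mult_mat_vec[OF M Bc w] B(1) w by simp
  have uniq: "v = u" if "v \<in> carrier_vec N" "M *\<^sub>v v = w" for v
    unfolding u_def using assoc_mult_mat_vec[OF Bc M that(1)] BM that by simp
  have iff: "KKT_solution n x f a z \<longleftrightarrow>
      a \<in> carrier_vec (mc_r n + 1) \<and> z \<in> carrier_vec (mc_m n + 1) \<and> M *\<^sub>v (a @\<^sub>v z) = w" for a z
    by (simp add: KKT_solution_def M_def w_def)
  show ?thesis
  proof (rule ex1I[of _ "(vec_first u (mc_r n + 1), vec_last u (mc_m n + 1))"])
    show "case (vec_first u (mc_r n + 1), vec_last u (mc_m n + 1)) of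
        (a, z) \<Rightarrow> KKT_solution n x f a z"
      using u Mu by (simp add: iff N_def)
  next
    fix s assume "case s of (a, z) \<Rightarrow> KKT_solution n x f a z"
    then obtain a z where s: "s = (a, z)" and az: "a \<in> carrier_vec (mc_r n + 1)"
      "z \<in> carrier_vec (mc_m n + 1)" "M *\<^sub>v (a @\<^sub>v z) = w"
      by (auto simp: iff)
    have *: "a @\<^sub>v z = u"
      using append_carrier_vec[OF az(1,2)] az(3) by (intro uniq) (simp_all add: N_def)
    have "u = vec_first u (mc_r n + 1) @\<^sub>v vec_last u (mc_m n + 1)"
      using u by (simp add: N_def)
    with * az(1) show "s = (vec_first u (mc_r n + 1), vec_last u (mc_m n + 1))"
      unfolding s by (metis append_vec_eq vec_first_carrier)
  qed
qed

end

theory Submission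
  imports Defs
begin

text \<open>
  The derivative of \<open>T\<^sub>k\<^sub>+\<^sub>1\<close> is \<open>(k + 1) U\<^sub>k\<close>, and since \<open>U\<^sub>k\<^sub>+\<^sub>2 = U\<^sub>k + 2 T\<^sub>k\<^sub>+\<^sub>2\<close>,
  the polynomial \<open>U\<^sub>k\<close> of the second kind is a sum of the \<open>T\<^sub>i\<close> with \<open>i \<le> k\<close> of the same parity as \<open>k\<close>.
  Differentiating a Chebyshev expansion term by term, exchanging the two sums and comparing
  coefficients gives the recurrence.
\<close>

text \<open>Chebyshev polynomials of the second kind, encoded by their expansion in the
  \<open>cheb_T\<close> basis so that coefficients can be read off directly. The weight of T_0 is 1
  because U_0 = T_0.\<close>

definition cheb_U :: "nat \<Rightarrow> real poly" where
  "cheb_U k = (\<Sum>i\<le>k. if even (k + i) then smult (if i = 0 then 1 else 2) (cheb_T i) else 0)"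

lemma smult_sum_right: "smult c (\<Sum>i\<in>A. p i) = (\<Sum>i\<in>A. smult c (p i))"
  by (induction A rule: infinite_finite_induct) (simp_all add: smult_add_right)

lemma cheb_T_rec: "cheb_T (Suc (Suc k)) = [:0, 2:] * cheb_T (Suc k) - cheb_T k"
  by (simp add: cheb_T_eq_rec)

lemma cheb_U_Suc_Suc_eq_add: "cheb_U (Suc (Suc k)) = cheb_U k + smult 2 (cheb_T (Suc (Suc k)))"
  by (simp add: cheb_U_def)

text \<open>U_(k+4) is U_(k+2) plus 2 T_(k+4), and both summands obey the same three-term
  recurrence. The induction thus advances by two, which is why two base cases are computed.\<close>

lemma cheb_U_rec: "cheb_U (Suc (Suc k)) = [:0, 2:] * cheb_U (Suc k) - cheb_U k"
proof (induction k rule: induct_nat_012)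
  case 0
  show ?case by (simp add: cheb_U_def cheb_T_eq_rec one_pCons)
next
  case 1
  show ?case by (simp add: cheb_U_def cheb_T_eq_rec one_pCons numeral_poly)
next
  case (ge2 k)
  define X :: "real poly" where "X = [:0, 2:]"
  have "cheb_U (Suc (Suc (Suc (Suc k))))
      = (X * cheb_U (Suc k) - cheb_U k) + smult 2 (X * cheb_T (Suc (Suc (Suc k))) - cheb_T (Suc (Suc k)))"
    unfolding cheb_U_Suc_Suc_eq_add[of "Suc (Suc k)"] cheb_T_rec[of "Suc (Suc k)"]
      ge2(1)[folded X_def] X_def[symmetric] ..
  also have "\<dots> = X * (cheb_U (Suc k) + smult 2 (cheb_T (Suc (Suc (Suc k)))))
      - (cheb_U k + smult 2 (cheb_T (Suc (Suc k))))"
    by (simp add: algebra_simps smult_diff_right)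
  also have "\<dots> = X * cheb_U (Suc (Suc (Suc k))) - cheb_U (Suc (Suc k))"
    by (simp only: cheb_U_Suc_Suc_eq_add)
  finally show ?case unfolding X_def .
qed

text \<open>Differentiating the recurrence of T by the product rule leaves an extra term 2 T_(k+2),
  which equals U_(k+2) - U_k; the recurrence of U then closes the induction.\<close>

lemma pderiv_cheb_T_Suc: "pderiv (cheb_T (Suc k)) = smult (real (Suc k)) (cheb_U k)"
proof (induction k rule: induct_nat_012)
  case 0
  show ?case by (simp add: cheb_U_def cheb_T_eq_rec pderiv_pCons)
next
  case 1
  show ?case by (simp add: cheb_U_def cheb_T_eq_rec pderiv_pCons pderiv_mult pderiv_diff)
next
  case (ge2 k)
  have "pderiv (cheb_T (Suc (Suc (Suc k))))
      = smult 2 (cheb_T (Suc (Suc k))) + [:0, 2:] * pderiv (cheb_T (Suc (Suc k)))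
        - pderiv (cheb_T (Suc k))"
    unfolding cheb_T_rec[of "Suc k"] pderiv_diff pderiv_mult by (simp add: pderiv_pCons)
  also have "\<dots> = (cheb_U (Suc (Suc k)) - cheb_U k)
      + smult (real (Suc (Suc k))) ([:0, 2:] * cheb_U (Suc k)) - smult (real (Suc k)) (cheb_U k)"
    unfolding ge2 cheb_U_Suc_Suc_eq_add by simp
  also have "[:0, 2:] * cheb_U (Suc k) = cheb_U (Suc (Suc k)) + cheb_U k"
    unfolding cheb_U_rec by simp
  \<comment> \<open>The coefficient of U_k is -1 + (k+2) - (k+1) = 0, and that of U_(k+2) is 1 +
    (k+2) = k+3.\<close>
  also have "(cheb_U (Suc (Suc k)) - cheb_U k)
      + smult (real (Suc (Suc k))) (cheb_U (Suc (Suc k)) + cheb_U k) - smult (real (Suc k)) (cheb_U k)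
      = smult (real (Suc (Suc (Suc k)))) (cheb_U (Suc (Suc k)))"
    by (rule poly_eqI) (simp add: algebra_simps)
  finally show ?case .
qed

text \<open>The expansion of k U_(k-1), padded with zero coefficients up to a common bound
  \<open>r\<close> so that the sums over \<open>k\<close> and \<open>i\<close> can later be
  exchanged.\<close>

lemma pderiv_cheb_T:
  assumes "k \<le> r"
  shows "pderiv (cheb_T k) =
    (\<Sum>i\<le>r. smult (if i < k \<and> odd (k + i) then (if i = 0 then 1 else 2) * real k else 0) (cheb_T i))"
proof (cases k)
  case 0
  then show ?thesis by (simp add: cheb_T_eq_rec)
next
  case (Suc l)
  have "pderiv (cheb_T k) = (\<Sum>i\<le>l. smult
      (if i < k \<and> odd (k + i) then (if i = 0 then 1 else 2) * real k else 0) (cheb_T i))"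
    unfolding Suc pderiv_cheb_T_Suc cheb_U_def smult_sum_right
    by (intro sum.cong) (auto simp: mult.commute)
  also have "\<dots> = (\<Sum>i\<le>r. smult
      (if i < k \<and> odd (k + i) then (if i = 0 then 1 else 2) * real k else 0) (cheb_T i))"
    using assms Suc by (intro sum.mono_neutral_left) auto
  finally show ?thesis .
qed

lemma pderiv_cheb_sum:
  "pderiv (\<Sum>k\<le>r. smult (a k) (cheb_T k)) =
    (\<Sum>i\<le>r. smult ((if i = 0 then 1 else 2) * (\<Sum>k\<in>{k. i < k \<and> k \<le> r \<and> odd (k + i)}. real k * a k))
      (cheb_T i))"
proof -
  let ?e = "\<lambda>i k. if i < k \<and> odd (k + i) then (if i = 0 then 1 else 2) * real k else (0::real)"
  have "pderiv (\<Sum>k\<le>r. smult (a k) (cheb_T k))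
      = (\<Sum>k\<le>r. \<Sum>i\<le>r. smult (a k * ?e i k) (cheb_T i))"
    \<comment> \<open>The instance with a single derivative moves \<open>pderiv\<close> under the
      sum.\<close>
    unfolding higher_pderiv_sum[of 1, simplified] pderiv_smult
    by (intro sum.cong refl) (simp add: pderiv_cheb_T[of _ r] smult_sum_right)
  also have "\<dots> = (\<Sum>i\<le>r. smult (\<Sum>k\<le>r. a k * ?e i k) (cheb_T i))"
    by (subst sum.swap) (simp only: smult_sum)
  finally have "pderiv (\<Sum>k\<le>r. smult (a k) (cheb_T k))
      = (\<Sum>i\<le>r. smult (\<Sum>k\<le>r. a k * ?e i k) (cheb_T i))" .
  moreover have "(\<Sum>k\<le>r. a k * ?e i k)
      = (if i = 0 then 1 else 2) * (\<Sum>k\<in>{k. i < k \<and> k \<le> r \<and> odd (k + i)}. real k * a k)" for i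
  proof -
    have "(\<Sum>k\<le>r. a k * ?e i k) = (\<Sum>k\<in>{k. i < k \<and> k \<le> r \<and> odd (k + i)}. a k * ?e i k)"
      by (intro sum.mono_neutral_right) auto
    then show ?thesis by (auto simp: sum_distrib_left mult_ac intro!: sum.cong)
  qed
  ultimately show ?thesis by (simp only:)
qed

text \<open>The substitution is k = i + 2j + 1. If r - i is even, the last \<open>j\<close> gives
  the index r + 1, so the range is first extended to r + 1, where \<open>g\<close> vanishes.\<close>

lemma sum_opposite_parity_reindex:
  fixes g :: "nat \<Rightarrow> 'a :: comm_monoid_add"
  assumes "g (r + 1) = 0" and "i \<le> r"
  shows "(\<Sum>k\<in>{k. i < k \<and> k \<le> r \<and> odd (k + i)}. g k) = (\<Sum>j=0..(r - i) div 2. g (i + 2 * j + 1))"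
proof -
  have "(\<Sum>k\<in>{k. i < k \<and> k \<le> r \<and> odd (k + i)}. g k)
      = (\<Sum>k\<in>{k. i < k \<and> k \<le> r + 1 \<and> odd (k + i)}. g k)"
    using assms(1) by (intro sum.mono_neutral_left) (auto simp: le_Suc_eq)
  also have "\<dots> = (\<Sum>j=0..(r - i) div 2. g (i + 2 * j + 1))"
  proof (rule sum.reindex_bij_witness[of _ "\<lambda>j. i + 2 * j + 1" "\<lambda>k. (k - i - 1) div 2"])
    fix k assume "k \<in> {k. i < k \<and> k \<le> r + 1 \<and> odd (k + i)}"
    then have k: "i < k" "k \<le> r + 1" "odd (k + i)" by simp_all
    then show inv: "i + 2 * ((k - i - 1) div 2) + 1 = k" by presburger
    show "(k - i - 1) div 2 \<in> {0..(r - i) div 2}" using k by (auto intro: div_le_mono)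
    show "g (i + 2 * ((k - i - 1) div 2) + 1) = g k" by (simp only: inv)
  next
    fix j assume "j \<in> {0..(r - i) div 2}"
    then have "2 * j \<le> r - i" by (auto simp: less_eq_div_iff_mult_less_eq)
    \<comment> \<open>The bound \<open>i \<le> r\<close> makes the truncated difference
      \<open>r - i\<close> exact.\<close>
    then show "i + 2 * j + 1 \<in> {k. i < k \<and> k \<le> r + 1 \<and> odd (k + i)}" using assms(2) by auto
  qed simp
  finally show ?thesis .
qed

lemma cheb_sum_eqD:
  assumes "(\<Sum>i\<le>r. smult (a i) (cheb_T i)) = (\<Sum>i\<le>r. smult (b i) (cheb_T i))" and "i \<le> r"
  shows "a i = b i"
  using cheb_T_independent[of "\<lambda>i. a i - b i" r i] assms
  by (simp add: smult_diff_left sum_subtractf)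

lemma cheb_coeffs_pderiv:
  assumes "pderiv (\<Sum>k\<le>r. smult (a k) (cheb_T k)) = (\<Sum>i\<le>r. smult (b i) (cheb_T i))"
    and "a (r + 1) = 0" and "i \<le> r"
  shows "b i = (if i = 0 then 1 else 2) *
    (\<Sum>j=0..(r - i) div 2. real (i + 2 * j + 1) * a (i + 2 * j + 1))"
proof -
  have "b i = (if i = 0 then 1 else 2) *
      (\<Sum>k\<in>{k. i < k \<and> k \<le> r \<and> odd (k + i)}. real k * a k)"
    using cheb_sum_eqD[OF assms(1)[symmetric, unfolded pderiv_cheb_sum] assms(3)] .
  then show ?thesis
    using sum_opposite_parity_reindex[of "\<lambda>k. real k * a k" r i] assms(2,3) by simp
qed

theorem theorem6:
  fixes n r :: nat and x :: "nat \<Rightarrow> real" and f :: "real \<Rightarrow> real"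
    and ahat :: "nat \<Rightarrow> nat \<Rightarrow> real"
  assumes "n > 0" and "r = mc_r n" and "r \<le> n"
    and "mock_chebyshev_ordering n x"
    and "continuous_on {-1..1} f"
    and "\<forall>\<nu>\<le>r. \<forall>t\<in>{-1..1}.
           poly ((pderiv ^^ \<nu>) (cmc_ls n x f)) t = (\<Sum>i\<le>r. ahat \<nu> i * poly (cheb_T i) t)"
    and "\<forall>\<nu>\<le>r. ahat \<nu> (r + 1) = 0"
  shows "\<forall>\<nu>\<in>{1..r}.
           ahat \<nu> 0 = (\<Sum>j=0..r div 2. real (2 * j + 1) * ahat (\<nu> - 1) (2 * j + 1)) \<and>
           (\<forall>i\<in>{1..r}. ahat \<nu> i =
              2 * (\<Sum>j=0..(r - i) div 2. real (i + 2 * j + 1) * ahat (\<nu> - 1) (i + 2 * j + 1)))"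
proof -
  \<comment> \<open>Agreement on the infinite set [-1,1] turns the pointwise expansions into
    polynomial identities.\<close>
  have expansion: "(pderiv ^^ \<nu>) (cmc_ls n x f) = (\<Sum>i\<le>r. smult (ahat \<nu> i) (cheb_T i))"
    if "\<nu> \<le> r" for \<nu>
    using assms(6) that by (intro poly_eqI_unit_interval) (simp add: poly_sum)
  have coeffs: "ahat \<nu> i = (if i = 0 then 1 else 2) *
      (\<Sum>j=0..(r - i) div 2. real (i + 2 * j + 1) * ahat (\<nu> - 1) (i + 2 * j + 1))"
    if "\<nu> \<in> {1..r}" and "i \<le> r" for \<nu> i
  proof (rule cheb_coeffs_pderiv)
    show "pderiv (\<Sum>k\<le>r. smult (ahat (\<nu> - 1) k) (cheb_T k)) = (\<Sum>i\<le>r. smult (ahat \<nu> i) (cheb_T i))"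
      \<comment> \<open>As \<nu> is positive, the derivative of order \<nu> is \<open>pderiv\<close>
        applied to the one of order \<nu> - 1.\<close>
      using that expansion[of "\<nu> - 1"] expansion[of \<nu>] by (cases \<nu>) simp_all
  qed (use that assms(7) in auto)
  show ?thesis
  proof (intro ballI conjI)
    fix \<nu> assume "\<nu> \<in> {1..r}"
    then show "ahat \<nu> 0 = (\<Sum>j=0..r div 2. real (2 * j + 1) * ahat (\<nu> - 1) (2 * j + 1))"
      using coeffs[of \<nu> 0] by simp
  next
    fix \<nu> i assume "\<nu> \<in> {1..r}" "i \<in> {1..r}"
    then show "ahat \<nu> i =
        2 * (\<Sum>j=0..(r - i) div 2. real (i + 2 * j + 1) * ahat (\<nu> - 1) (i + 2 * j + 1))"
      using coeffs[of \<nu> i] by simp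
  qed
qed

end
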